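(* Let $\mathbf t,\mathbf t'$ be two directions not parallel to each other, and let $f,g\in O_n$ be such that the intersection $C_{\mathbf t,\mathbf t'}:=L_{\mathbf t,\mathbf t'}(f)\cap L_{\mathbf t,\mathbf t'}(g)$ contains some $(\mathbf k,\mathbf k')\neq0$ such that the slope of either $\mathbf k$ or $\mathbf k'$ is not a fraction over $\mathbb Z_p$. Let the mask $\mu$ satisfy the Mask Assumption. Suppose that $$|\mathcal F(\mu\odot e^{\mathrm i\kappa g^*_{\mathbf t'}})|^2=|\mathcal F(\mu\odot e^{\mathrm i\kappa f^*_{\mathbf t'}})|^2\quad\text{and}\quad|\mathcal F(\mu\odot e^{\mathrm i\kappa g^*_{\mathbf t}})|^2=|\mathcal F(\mu\odot e^{\mathrm i\kappa f^*_{\mathbf t}})|^2.$$ Then $e^{\mathrm i\kappa g_{\mathbf t}}=e^{\mathrm i\kappa f_{\mathbf t}}$ and $e^{\mathrm i\kappa g_{\mathbf t'}}=e^{\mathrm i\kappa f_{\mathbf t'}}$ almost surely.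
   Context: Let $n$ be a positive odd integer, $p=2n-1$, and for odd $m$ let $\mathbb Z_m=\{-(m-1)/2,\dots,(m-1)/2\}$. $O_n$ is the set of all functions $f:\mathbb Z_n^3\to\mathbb C$. The wavenumber is $\kappa=\pi$. Let $D_p(t)=\frac1p\sum_{l\in\mathbb Z_p}e^{\mathrm i2\pi lt/p}$ and, for $f\in O_n$, $\widetilde f(x,y,z)=\sum_{i,j,k\in\mathbb Z_n}f(i,j,k)D_p(x-i)D_p(y-j)D_p(z-k)$ for $x,y,z\in\mathbb R$. Directions $\mathbf t$ are vectors of one of the forms $(1,\alpha,\beta)$, $(\alpha,1,\beta)$, $(\alpha,\beta,1)$ with $|\alpha|,|\beta|<1$. The discrete projection $f_{\mathbf t}:\mathbb Z_p^2\to\mathbb C$ is, for $(c_1,c_2)\in\mathbb Z_p^2$, $f_{(1,\alpha,\beta)}(c_1,c_2)=\sum_{i\in\mathbb Z_n}\widetilde f(i,\alpha i+c_1,\beta i+c_2)$, $f_{(\alpha,1,\beta)}(c_1,c_2)=\sum_{j\in\mathbb Z_n}\widetilde f(\alpha j+c_1,j,\beta j+c_2)$, $f_{(\alpha,\beta,1)}(c_1,c_2)=\sum_{k\in\mathbb Z_n}\widetilde f(\alpha k+c_1,\beta k+c_2,k)$. Translated projections: for each direction $\mathbf t$ there is a shift $\mathbf l_{\mathbf t}\in\mathbb Z^2$ (the same for $f$ and $g$), and $f^*_{\mathbf t}(\mathbf n)=f_{\mathbf t}(\mathbf n+\mathbf l_{\mathbf t})$, $g^*_{\mathbf t}(\mathbf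 n)=g_{\mathbf t}(\mathbf n+\mathbf l_{\mathbf t})$ (projections being extended by zero outside $\mathbb Z_p^2$). It is a standing assumption that $\operatorname{supp}(f^*_{\mathbf t})\subseteq\mathbb Z_n^2$ and $\operatorname{supp}(g^*_{\mathbf t})\subseteq\mathbb Z_n^2$. Common set: with $\widehat f_{\mathbf t}(\mathbf k)=\sum_{\mathbf j\in\mathbb Z_p^2}f_{\mathbf t}(\mathbf j)e^{-\mathrm i2\pi\mathbf k\cdot\mathbf j/p}$, $\mathbf k\in\mathbb R^2$, put $L_{\mathbf t,\mathbf t'}(f)=\{(\mathbf k,\mathbf k')\in\mathbb R^2\times\mathbb R^2:\widehat f_{\mathbf t}(\mathbf k)=\widehat f_{\mathbf t'}(\mathbf k')\}$. The slope of $\mathbf k=(k_1,k_2)$ is not a fraction over $\mathbb Z_p$ if $k_1\neq0$ and $k_2/k_1\neq a/b$ for all $a,b\in\mathbb Z_p$, $b\neq0$. For $u:\mathbb Z_p^2\to\mathbb C$, $\mathcal F(u)(\mathbf w)=\sum_{\mathbf n\in\mathbb Z_p^2}u(\mathbf n)e^{-\mathrm i2\pi\mathbf n\cdot\mathbf w}$, $\mathbf w\in[-\frac12,\frac12]^2$; $\odot$ is the entrywise product, and $e^{\mathrm i\kappa f^*_{\mathbf t}}$ is taken entrywise on $\mathbb Z_p^2$. Equalities of $|\mathcal F(\cdot)|^2$ are on $[-\frac12,\frac12]^2$. Mask Assumption: $\mu(\mathbf n)=\exp[\mathrm i\phi(\mathbf n)]$ with independent, continuous random variables $\phi(\mathbf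 n)\in\mathbb R$. "Almost surely" is with respect to this randomness.
   Formalization: The formal theorem takes n > 1 odd: for n = 1 the claim fails, since f = 0 and g = 1 with zero shift satisfy every hypothesis and have equal intensities, but e^{iπg} = -1 differs from e^{iπf} = 1. *)

theory Defs
  imports "HOL-Probability.Probability"
begin

definition Zsym :: "nat \<Rightarrow> int set" where
  "Zsym m = {- ((int m - 1) div 2) .. (int m - 1) div 2}"

definition dirichlet :: "nat \<Rightarrow> real \<Rightarrow> complex" where
  "dirichlet p t = (1 / of_nat p) * (\<Sum>l\<in>Zsym p. exp (\<i> * of_real (2 * pi * of_int l * t / of_nat p)))"

(* An element of O_n is given by a total function on int * int * int; only its values on
   Zsym n \<times> Zsym n \<times> Zsym n enter any of the definitions below. *)
type_synonym object3 = "int \<times> int \<times> int \<Rightarrow> complex"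

definition interp :: "nat \<Rightarrow> object3 \<Rightarrow> real \<Rightarrow> real \<Rightarrow> real \<Rightarrow> complex" where
  "interp n f x y z =
     (\<Sum>i\<in>Zsym n. \<Sum>j\<in>Zsym n. \<Sum>k\<in>Zsym n.
        f (i, j, k) * dirichlet (2 * n - 1) (x - of_int i)
                    * dirichlet (2 * n - 1) (y - of_int j)
                    * dirichlet (2 * n - 1) (z - of_int k))"

definition is_direction :: "real \<times> real \<times> real \<Rightarrow> bool" where
  "is_direction t \<longleftrightarrow>
     (\<exists>\<alpha> \<beta>. \<bar>\<alpha>\<bar> < 1 \<and> \<bar>\<beta>\<bar> < 1 \<and> (t = (1, \<alpha>, \<beta>) \<or> t = (\<alpha>, 1, \<beta>) \<or> t = (\<alpha>, \<beta>, 1)))"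

definition parallel_dirs :: "real \<times> real \<times> real \<Rightarrow> real \<times> real \<times> real \<Rightarrow> bool" where
  "parallel_dirs t t' \<longleftrightarrow> (\<exists>r. r \<noteq> 0 \<and> t' = r *\<^sub>R t)"

(* The projection f_t on (Zsym (2n-1))^2, extended by zero to all of int * int.
   A direction has exactly one entry equal to 1, so the case distinction selects the form of t. *)
definition discrete_proj :: "nat \<Rightarrow> object3 \<Rightarrow> real \<times> real \<times> real \<Rightarrow> int \<times> int \<Rightarrow> complex" where
  "discrete_proj n f = (\<lambda>(a, b, c) (c1, c2).
     if (c1, c2) \<in> Zsym (2 * n - 1) \<times> Zsym (2 * n - 1) then
       if a = 1 then
         (\<Sum>i\<in>Zsym n. interp n f (of_int i) (b * of_int i + of_int c1) (c * of_int i + of_int c2))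
       else if b = 1 then
         (\<Sum>j\<in>Zsym n. interp n f (a * of_int j + of_int c1) (of_int j) (c * of_int j + of_int c2))
       else
         (\<Sum>k\<in>Zsym n. interp n f (a * of_int k + of_int c1) (b * of_int k + of_int c2) (of_int k))
     else 0)"

definition tproj ::
  "nat \<Rightarrow> (real \<times> real \<times> real \<Rightarrow> int \<times> int) \<Rightarrow> object3 \<Rightarrow> real \<times> real \<times> real \<Rightarrow> int \<times> int \<Rightarrow> complex"
  where "tproj n l f t m = discrete_proj n f t (m + l t)"

definition proj_hat :: "nat \<Rightarrow> object3 \<Rightarrow> real \<times> real \<times> real \<Rightarrow> real \<times> real \<Rightarrow> complex" where
  "proj_hat n f t k =
     (\<Sum>(j1, j2)\<in>Zsym (2 * n - 1) \<times> Zsym (2 * n - 1).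
        discrete_proj n f t (j1, j2) *
        exp (- \<i> * of_real (2 * pi * (fst k * of_int j1 + snd k * of_int j2) / of_nat (2 * n - 1))))"

definition common_set ::
  "nat \<Rightarrow> real \<times> real \<times> real \<Rightarrow> real \<times> real \<times> real \<Rightarrow> object3 \<Rightarrow> ((real \<times> real) \<times> (real \<times> real)) set"
  where "common_set n t t' f = {(k, k'). proj_hat n f t k = proj_hat n f t' k'}"

definition slope_not_fraction :: "nat \<Rightarrow> real \<times> real \<Rightarrow> bool" where
  "slope_not_fraction p k \<longleftrightarrow>
     fst k \<noteq> 0 \<and> (\<forall>a\<in>Zsym p. \<forall>b\<in>Zsym p. b \<noteq> 0 \<longrightarrow> snd k / fst k \<noteq> of_int a / of_int b)"

definition fourier :: "nat \<Rightarrow> (int \<times> int \<Rightarrow> complex) \<Rightarrow> real \<times> real \<Rightarrow> complex" where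
  "fourier p u w =
     (\<Sum>(n1, n2)\<in>Zsym p \<times> Zsym p.
        u (n1, n2) * exp (- \<i> * of_real (2 * pi * (of_int n1 * fst w + of_int n2 * snd w))))"

definition \<kappa> :: complex where "\<kappa> = of_real pi"

definition phase_mask :: "(int \<times> int \<Rightarrow> 'w \<Rightarrow> real) \<Rightarrow> 'w \<Rightarrow> int \<times> int \<Rightarrow> complex" where
  "phase_mask \<phi> \<omega> m = exp (\<i> * of_real (\<phi> m \<omega>))"

(* "Continuous random variable" is read as: the distribution function is continuous.  This
   includes the case of random variables with a density. *)
definition mask_assumption :: "'w measure \<Rightarrow> nat \<Rightarrow> (int \<times> int \<Rightarrow> 'w \<Rightarrow> real) \<Rightarrow> bool" where
  "mask_assumption M p \<phi> \<longleftrightarrow>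
     prob_space M \<and>
     prob_space.indep_vars M (\<lambda>_. borel) \<phi> (Zsym p \<times> Zsym p) \<and>
     (\<forall>m\<in>Zsym p \<times> Zsym p. \<forall>x. isCont (cdf (distr M borel (\<phi> m))) x)"

definition coded_intensity ::
  "nat \<Rightarrow> (int \<times> int \<Rightarrow> complex) \<Rightarrow> (int \<times> int \<Rightarrow> complex) \<Rightarrow> real \<times> real \<Rightarrow> real" where
  "coded_intensity p \<mu> h w = (cmod (fourier p (\<lambda>m. \<mu> m * exp (\<i> * \<kappa> * h m)) w))\<^sup>2"

(* The theorem is stated for odd n > 1.  For n = 1 all projections are the single value f(0,0,0) (zero shift),
   every slope with nonzero first coordinate is vacuously "not a fraction", and f = 0, g = 1 have
   equal coded intensities although exp (i * pi * g) = -1 differs from exp (i * pi * f) = 1. *)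

end

theory Submission
  imports Defs
begin

text \<open>
  Equality of the coded intensities of \<open>f\<close> and \<open>g\<close> on the square means that the masked
  objects have the same autocorrelation.  Let \<open>u\<close>, \<open>v\<close> be the two unmasked exponentials, and
  suppose \<open>u m \<noteq> v m\<close>; then \<open>m\<close> lies in the small square, so the corner \<open>b\<close> of the large
  square satisfies \<open>u b = v b = 1\<close>.  At the lag \<open>m - b\<close> the mask value at \<open>b\<close> occurs
  in a single term of the autocorrelation, because \<open>2 b - m\<close> leaves the large square.  The
  difference of the two autocorrelations is therefore an equation that determines the mask value
  at \<open>b\<close> by the independent values elsewhere, which has probability zero.  As \<open>f\<close> and \<open>g\<close>
  do not depend on the mask, each direction can be treated on its own.
\<close>

section \<open>Null events for atomless and independent random variables\<close>

lemma countable_exp_ii_eq: "countable {x::real. exp (\<i> * of_real x) = c}"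
proof (cases "\<exists>x0::real. exp (\<i> * of_real x0) = c")
  case True
  then obtain x0 :: real where x0: "exp (\<i> * of_real x0) = c" ..
  have "{x::real. exp (\<i> * of_real x) = c} \<subseteq> range (\<lambda>k::int. x0 + 2 * of_int k * pi)"
  proof
    fix x :: real assume "x \<in> {x. exp (\<i> * of_real x) = c}"
    then have "exp (\<i> * of_real x) = exp (\<i> * of_real x0)" using x0 by simp
    then obtain k :: int where k: "\<i> * of_real x = \<i> * of_real x0 + (of_int (2 * k) * of_real pi) * \<i>"
      unfolding exp_eq by auto
    from arg_cong[OF k, of Im] have "x = x0 + 2 * of_int k * pi" by simp
    then show "x \<in> range (\<lambda>k::int. x0 + 2 * of_int k * pi)" by blast
  qed
  then show ?thesis by (rule countable_subset) simp
qed simp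

text \<open>A continuous distribution function has no jumps, so the law has no atoms, and a
  countable union of null singletons is null.\<close>

lemma (in prob_space) AE_notin_countable:
  fixes X :: "'a \<Rightarrow> real"
  assumes X: "X \<in> borel_measurable M"
    and cont: "\<And>x. isCont (cdf (distr M borel X)) x"
    and S: "countable S"
  shows "AE \<omega> in M. X \<omega> \<notin> S"
proof -
  interpret X: real_distribution "distr M borel X" using X by (rule real_distribution_distr)
  have "measure (distr M borel X) {x} = 0" for x
    using cont X.isCont_cdf by blast
  then have "{x} \<in> null_sets (distr M borel X)" for x
    by (simp add: null_sets_def X.emeasure_eq_measure)
  then have "(\<Union>x\<in>S. {x}) \<in> null_sets (distr M borel X)"
    by (intro null_sets_UN' S)
  from AE_distrD[OF X AE_not_in[OF this]] show ?thesis by simp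
qed

text \<open>Fubini: by independence the joint law is the product of the two laws, so a measurable
  set with null sections is null. This is conditioning on \<open>Y\<close> without conditional
  probabilities.\<close>

lemma (in prob_space) AE_indep_var:
  assumes ind: "indep_var N Y S X"
    and P: "{z \<in> space (N \<Otimes>\<^sub>M S). P z} \<in> sets (N \<Otimes>\<^sub>M S)"
    and sections: "\<And>y. y \<in> space N \<Longrightarrow> AE \<omega> in M. P (y, X \<omega>)"
  shows "AE \<omega> in M. P (Y \<omega>, X \<omega>)"
proof -
  have X[measurable]: "X \<in> measurable M S" and Y[measurable]: "Y \<in> measurable M N"
    and eq: "distr M N Y \<Otimes>\<^sub>M distr M S X = distr M (N \<Otimes>\<^sub>M S) (\<lambda>\<omega>. (Y \<omega>, X \<omega>))"
    using ind unfolding indep_var_distribution_eq by auto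
  interpret X: prob_space "distr M S X" by (rule prob_space_distr) simp
  interpret Y: prob_space "distr M N Y" by (rule prob_space_distr) simp
  interpret XY: pair_sigma_finite "distr M N Y" "distr M S X" ..
  have "AE x in distr M S X. P (y, x)" if y: "y \<in> space N" for y
  proof -
    have "{x \<in> space S. P (y, x)} = Pair y -` {z \<in> space (N \<Otimes>\<^sub>M S). P z}"
      using y by (auto simp: space_pair_measure)
    then have "{x \<in> space S. P (y, x)} \<in> sets S" using sets_Pair1[OF P] by simp
    then show ?thesis using sections[OF y] by (subst AE_distr_iff) simp_all
  qed
  then have sections': "AE y in distr M N Y. AE x in distr M S X. P (y, x)"
    by (rule AE_I2) simp
  have "AE z in distr M N Y \<Otimes>\<^sub>M distr M S X. P z"
  proof (rule XY.AE_pair_measure[OF _ sections'])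
    have "sets (distr M N Y \<Otimes>\<^sub>M distr M S X) = sets (N \<Otimes>\<^sub>M S)"
      by (intro sets_pair_measure_cong) simp_all
    moreover have "space (distr M N Y \<Otimes>\<^sub>M distr M S X) = space (N \<Otimes>\<^sub>M S)"
      by (simp add: space_pair_measure)
    ultimately show "{z \<in> space (distr M N Y \<Otimes>\<^sub>M distr M S X). P z}
        \<in> sets (distr M N Y \<Otimes>\<^sub>M distr M S X)"
      using P by simp
  qed
  then have "AE z in distr M (N \<Otimes>\<^sub>M S) (\<lambda>\<omega>. (Y \<omega>, X \<omega>)). P z"
    unfolding eq .
  then show ?thesis
    by (subst (asm) AE_distr_iff[OF _ P]) simp_all
qed

text \<open>The pairs in \<open>D\<close> avoid \<open>b\<close>, so once the other phases are
  fixed, the phase at \<open>b\<close> enters only the first term. As \<open>A\<close> is nonzero,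
  vanishing of the sum prescribes a value of exp (i x) at that phase x, which leaves countably many
  x.\<close>

lemma (in prob_space) AE_phase_sum_nonzero:
  fixes \<phi> :: "'i \<Rightarrow> 'a \<Rightarrow> real" and C :: "'i \<times> 'i \<Rightarrow> complex"
  assumes ind: "indep_vars (\<lambda>_. borel) \<phi> G"
    and cont: "\<And>x. isCont (cdf (distr M borel (\<phi> b))) x"
    and b: "b \<in> G" and m: "m \<in> G - {b}" and D: "D \<subseteq> (G - {b}) \<times> (G - {b})"
    and A: "A \<noteq> 0"
  shows "AE \<omega> in M.
    A * (exp (\<i> * of_real (\<phi> m \<omega>)) * cnj (exp (\<i> * of_real (\<phi> b \<omega>)))) +
    (\<Sum>x\<in>D. C x * (exp (\<i> * of_real (\<phi> (fst x) \<omega>)) * cnj (exp (\<i> * of_real (\<phi> (snd x) \<omega>))))) \<noteq> 0"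
proof -
  let ?H = "G - {b}"
  let ?N = "PiM ?H (\<lambda>_. borel) :: ('i \<Rightarrow> real) measure"
  \<comment> \<open>The phase at \<open>b\<close> is kept as a function on a singleton, the shape in
    which independence of disjoint groups of variables is obtained; hence the later
    \<open>snd z b\<close>.\<close>
  let ?B = "PiM {b} (\<lambda>_. borel) :: ('i \<Rightarrow> real) measure"
  let ?e = "\<lambda>x::real. exp (\<i> * of_real x)"
  define T where "T = (\<lambda>y x. A * (?e (y m) * cnj (?e x)) +
      (\<Sum>z\<in>D. C z * (?e (y (fst z)) * cnj (?e (y (snd z))))))"
  have \<phi>b: "\<phi> b \<in> borel_measurable M"
    using ind b by (auto simp: indep_vars_def)
  have cnj_meas: "(\<lambda>z. cnj (h z)) \<in> borel_measurable (?N \<Otimes>\<^sub>M ?B)"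
    if "h \<in> borel_measurable (?N \<Otimes>\<^sub>M ?B)" for h
    by (rule borel_measurable_continuous_on[OF _ that]) (intro continuous_intros)
  have fst_meas: "(\<lambda>z. fst z a) \<in> borel_measurable (?N \<Otimes>\<^sub>M ?B)" if "a \<in> ?H" for a
    using that by (intro measurable_compose[OF measurable_fst]) simp
  have snd_meas: "(\<lambda>z. snd z b) \<in> borel_measurable (?N \<Otimes>\<^sub>M ?B)"
    by (intro measurable_compose[OF measurable_snd]) simp
  have e_meas: "(\<lambda>z. ?e (h z)) \<in> borel_measurable (?N \<Otimes>\<^sub>M ?B)"
    if "h \<in> borel_measurable (?N \<Otimes>\<^sub>M ?B)" for h
    by (rule borel_measurable_continuous_on[OF _ that]) (intro continuous_intros)
  have meas: "(\<lambda>z. T (fst z) (snd z b)) \<in> borel_measurable (?N \<Otimes>\<^sub>M ?B)"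
    unfolding T_def using m D
    by (intro borel_measurable_add borel_measurable_sum borel_measurable_times
        borel_measurable_const cnj_meas e_meas fst_meas snd_meas) auto
  have "AE \<omega> in M. (\<lambda>z. T (fst z) (snd z b) \<noteq> 0)
      (restrict (\<lambda>i. \<phi> i \<omega>) ?H, restrict (\<lambda>i. \<phi> i \<omega>) {b})"
  proof (rule AE_indep_var)
    show "indep_var ?N (\<lambda>\<omega>. restrict (\<lambda>i. \<phi> i \<omega>) ?H) ?B (\<lambda>\<omega>. restrict (\<lambda>i. \<phi> i \<omega>) {b})"
      using ind b by (intro indep_var_restrict) auto
    show "{z \<in> space (?N \<Otimes>\<^sub>M ?B). T (fst z) (snd z b) \<noteq> 0} \<in> sets (?N \<Otimes>\<^sub>M ?B)"
      using meas by measurable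
  next
    fix y :: "'i \<Rightarrow> real"
    define R where "R = (\<Sum>z\<in>D. C z * (?e (y (fst z)) * cnj (?e (y (snd z)))))"
    have "{x. T y x = 0} \<subseteq> {x. ?e x = cnj (- R / (A * ?e (y m)))}"
    proof
      fix x assume "x \<in> {x. T y x = 0}"
      then have "A * ?e (y m) * cnj (?e x) = - R"
        by (simp add: T_def R_def eq_neg_iff_add_eq_0 mult.assoc)
      then have "cnj (?e x) = - R / (A * ?e (y m))"
        using A by (simp add: field_simps)
      then have "cnj (cnj (?e x)) = cnj (- R / (A * ?e (y m)))" by (rule arg_cong)
      then show "x \<in> {x. ?e x = cnj (- R / (A * ?e (y m)))}"
        by (simp only: complex_cnj_cnj mem_Collect_eq)
    qed
    then have "countable {x. T y x = 0}"
      by (rule countable_subset) (rule countable_exp_ii_eq)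
    from AE_notin_countable[OF \<phi>b cont this]
    show "AE \<omega> in M. T (fst (y, restrict (\<lambda>i. \<phi> i \<omega>) {b})) (snd (y, restrict (\<lambda>i. \<phi> i \<omega>) {b}) b) \<noteq> 0"
      by simp
  qed
  \<comment> \<open>\<open>T\<close> reads its first argument only at \<open>m\<close> and at
    entries of pairs in \<open>D\<close>, all inside \<open>?H\<close>.\<close>
  moreover have "T (restrict (\<lambda>i. \<phi> i \<omega>) ?H) x = T (\<lambda>i. \<phi> i \<omega>) x" for x \<omega>
  proof -
    have "(\<Sum>z\<in>D. C z * (?e (restrict (\<lambda>i. \<phi> i \<omega>) ?H (fst z)) * cnj (?e (restrict (\<lambda>i. \<phi> i \<omega>) ?H (snd z)))))
      = (\<Sum>z\<in>D. C z * (?e (\<phi> (fst z) \<omega>) * cnj (?e (\<phi> (snd z) \<omega>))))"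
      using D by (intro sum.cong refl) (auto simp: restrict_def)
    then show ?thesis using m by (simp only: T_def) simp
  qed
  ultimately show ?thesis by (simp add: T_def)
qed

section \<open>Recovering the autocorrelation from sampled intensities\<close>

text \<open>The sample points \<open>j / q - 1 / 2\<close> lie in the interval on which intensities are compared.\<close>

lemma sum_exp_sample_points:
  fixes k :: int
  assumes "\<bar>k\<bar> < int q"
  shows "(\<Sum>j<q. exp (\<i> * of_real (2 * pi * (of_int k * (real j / real q - 1/2)))))
    = (if k = 0 then of_nat q else 0)"
proof (cases "k = 0")
  case False
  have q: "q > 0" using assms by (cases q) auto
  define z where "z = exp (\<i> * of_real (2 * pi * of_int k / real q))"
  have zq: "z ^ q = 1"
  proof -
    have "z ^ q = exp (of_nat q * (\<i> * of_real (2 * pi * of_int k / real q)))"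
      unfolding z_def by (rule exp_of_nat_mult[symmetric])
    also have "of_nat q * (\<i> * of_real (2 * pi * of_int k / real q)) = \<i> * of_real (2 * pi * of_int k)"
      using q by simp
    also have "exp \<dots> = 1" unfolding exp_eq_1 by (auto intro!: exI[of _ k])
    finally show ?thesis .
  qed
  \<comment> \<open>Otherwise \<open>q\<close> would divide \<open>k\<close>, impossible for a
    nonzero \<open>k\<close> smaller than \<open>q\<close> in absolute value.\<close>
  have "z \<noteq> 1"
  proof
    assume "z = 1"
    then obtain r :: int where "2 * pi * of_int k / real q = of_int (2 * r) * pi"
      unfolding z_def exp_eq_1 by auto
    then have "of_int k = (of_int (r * int q) :: real)" using q by (simp add: field_simps)
    then have "k = r * int q" by (simp only: of_int_eq_iff)
    then have "int q dvd k" by simp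
    then show False using False assms zdvd_imp_le[of "int q" "\<bar>k\<bar>"] by simp
  qed
  \<comment> \<open>The offset -1/2 contributes a factor independent of \<open>j\<close>; what
    remains is a geometric sum over a nontrivial root of unity.\<close>
  have "(\<Sum>j<q. exp (\<i> * of_real (2 * pi * (of_int k * (real j / real q - 1/2)))))
    = (\<Sum>j<q. exp (- (\<i> * of_real (pi * of_int k))) * z ^ j)"
    unfolding z_def
    by (intro sum.cong refl) (simp add: exp_of_nat_mult[symmetric] exp_add[symmetric] algebra_simps)
  also have "\<dots> = exp (- (\<i> * of_real (pi * of_int k))) * (\<Sum>j<q. z ^ j)"
    by (rule sum_distrib_left[symmetric])
  also have "(\<Sum>j<q. z ^ j) = 0"
    using geometric_sum[OF \<open>z \<noteq> 1\<close>, of q] zq by simp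
  finally show ?thesis using False by simp
qed simp

text \<open>The intensity is a trigonometric polynomial whose coefficients are the autocorrelation
  of \<open>u\<close>; discrete orthogonality on a finite grid extracts the coefficient at lag
  \<open>d\<close>.\<close>

lemma fourier_autocorrelation:
  fixes u :: "int \<times> int \<Rightarrow> complex" and d :: "int \<times> int"
  assumes d: "\<bar>fst d\<bar> \<le> int p" "\<bar>snd d\<bar> \<le> int p" and p: "p > 0"
  defines "G \<equiv> Zsym p \<times> Zsym p"
  defines "s \<equiv> (\<lambda>j. real j / real (2 * p) - 1/2)"
  shows "(\<Sum>j<2 * p. \<Sum>i<2 * p. of_real ((cmod (fourier p u (s j, s i)))\<^sup>2) *
      exp (\<i> * of_real (2 * pi * (of_int (fst d) * s j + of_int (snd d) * s i))))
    = of_nat (2 * p) ^ 2 * (\<Sum>(a, b)\<in>{x \<in> G \<times> G. fst x - snd x = d}. u a * cnj (u b))"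
proof -
  let ?e = "\<lambda>x::real. exp (\<i> * of_real (2 * pi * x))"
  have fin: "finite G" by (simp add: G_def Zsym_def)
  \<comment> \<open>\<open>k1\<close> and \<open>k2\<close> are the frequencies left after
    modulation by \<open>d\<close>; both vanish exactly for pairs at lag \<open>d\<close>.\<close>
  define k1 where "k1 = (\<lambda>x::(int\<times>int)\<times>(int\<times>int). fst d - (fst (fst x) - fst (snd x)))"
  define k2 where "k2 = (\<lambda>x::(int\<times>int)\<times>(int\<times>int). snd d - (snd (fst x) - snd (snd x)))"
  have F: "fourier p u w = (\<Sum>a\<in>G. u a * ?e (- (of_int (fst a) * fst w + of_int (snd a) * snd w)))" for w
    unfolding fourier_def G_def by (intro sum.cong) (auto simp: algebra_simps)
  have sq: "of_real ((cmod (fourier p u (s j, s i)))\<^sup>2) * ?e (of_int (fst d) * s j + of_int (snd d) * s i)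
    = (\<Sum>x\<in>G\<times>G. u (fst x) * cnj (u (snd x)) * (?e (of_int (k1 x) * s j) * ?e (of_int (k2 x) * s i)))"
    (is "?L = _") for i j
  proof -
    have "?L = (\<Sum>a\<in>G. \<Sum>b\<in>G. u a * ?e (- (of_int (fst a) * s j + of_int (snd a) * s i)) *
        cnj (u b * ?e (- (of_int (fst b) * s j + of_int (snd b) * s i))) *
        ?e (of_int (fst d) * s j + of_int (snd d) * s i))"
      unfolding complex_norm_square F cnj_sum sum_product by (simp add: sum_distrib_right)
    also have "\<dots> = (\<Sum>a\<in>G. \<Sum>b\<in>G. u a * cnj (u b) *
        (?e (of_int (k1 (a, b)) * s j) * ?e (of_int (k2 (a, b)) * s i)))"
    proof (intro sum.cong refl)
      fix a b
      have "cnj (?e x) = ?e (- x)" for x by (simp add: exp_cnj)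
      moreover have "?e x * ?e y = ?e (x + y)" for x y
        by (simp add: exp_add[symmetric] algebra_simps)
      ultimately have "?e (- (of_int (fst a) * s j + of_int (snd a) * s i)) *
          cnj (?e (- (of_int (fst b) * s j + of_int (snd b) * s i))) *
          ?e (of_int (fst d) * s j + of_int (snd d) * s i)
        = ?e (of_int (k1 (a, b)) * s j) * ?e (of_int (k2 (a, b)) * s i)"
        by (simp only:) (rule arg_cong[where f = ?e], simp add: k1_def k2_def algebra_simps)
      then show "u a * ?e (- (of_int (fst a) * s j + of_int (snd a) * s i)) *
          cnj (u b * ?e (- (of_int (fst b) * s j + of_int (snd b) * s i))) *
          ?e (of_int (fst d) * s j + of_int (snd d) * s i)
        = u a * cnj (u b) * (?e (of_int (k1 (a, b)) * s j) * ?e (of_int (k2 (a, b)) * s i))"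
        by (simp only: complex_cnj_mult ac_simps)
    qed
    finally show ?thesis by (simp add: sum.cartesian_product case_prod_unfold)
  qed
  have orth: "(\<Sum>j<2 * p. ?e (of_int (k1 x) * s j) * (\<Sum>i<2 * p. ?e (of_int (k2 x) * s i)))
    = (if fst x - snd x = d then of_nat (2 * p) ^ 2 else 0)" if x: "x \<in> G \<times> G" for x
  proof -
    \<comment> \<open>Differences within \<open>G\<close> are at most p - 1 in each coordinate and
      those of \<open>d\<close> at most p, so frequencies stay below 2p: with 2p samples per axis
      there is no aliasing.\<close>
    have "\<bar>k1 x\<bar> < int (2 * p)" "\<bar>k2 x\<bar> < int (2 * p)"
      using x d p by (cases x; auto simp: k1_def k2_def G_def Zsym_def; linarith)+
    note sums = this[THEN sum_exp_sample_points]
    have "(\<Sum>j<2 * p. ?e (of_int (k1 x) * s j) * (\<Sum>i<2 * p. ?e (of_int (k2 x) * s i)))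
      = (\<Sum>j<2 * p. ?e (of_int (k1 x) * s j)) * (\<Sum>i<2 * p. ?e (of_int (k2 x) * s i))"
      by (rule sum_distrib_right[symmetric])
    also have "\<dots> = (if k1 x = 0 then of_nat (2 * p) else 0) * (if k2 x = 0 then of_nat (2 * p) else 0)"
      unfolding s_def sums ..
    also have "\<dots> = (if fst x - snd x = d then of_nat (2 * p) ^ 2 else 0)"
      by (cases x; cases d) (auto simp: k1_def k2_def power2_eq_square)
    finally show ?thesis .
  qed
  have "(\<Sum>j<2 * p. \<Sum>i<2 * p. of_real ((cmod (fourier p u (s j, s i)))\<^sup>2) *
      ?e (of_int (fst d) * s j + of_int (snd d) * s i))
    = (\<Sum>j<2 * p. \<Sum>x\<in>G\<times>G. \<Sum>i<2 * p. u (fst x) * cnj (u (snd x)) *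
        (?e (of_int (k1 x) * s j) * ?e (of_int (k2 x) * s i)))"
    unfolding sq by (intro sum.cong refl sum.swap)
  also have "\<dots> = (\<Sum>x\<in>G\<times>G. \<Sum>j<2 * p. \<Sum>i<2 * p. u (fst x) * cnj (u (snd x)) *
        (?e (of_int (k1 x) * s j) * ?e (of_int (k2 x) * s i)))"
    by (rule sum.swap)
  also have "\<dots> = (\<Sum>x\<in>G\<times>G. if fst x - snd x = d
      then of_nat (2 * p) ^ 2 * (u (fst x) * cnj (u (snd x))) else 0)"
    unfolding sum_distrib_left[symmetric] by (intro sum.cong refl) (simp only: orth, simp)
  also have "\<dots> = (\<Sum>x\<in>{x \<in> G \<times> G. fst x - snd x = d}. of_nat (2 * p) ^ 2 * (u (fst x) * cnj (u (snd x))))"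
    using fin by (intro sum.inter_filter[symmetric]) simp
  finally show ?thesis by (simp add: sum_distrib_left case_prod_unfold)
qed

section \<open>Almost sure distinction of coded intensities\<close>

text \<open>The hypothesis compares products of values at \<open>m\<close> and \<open>b\<close>,
  since a common unimodular factor of the exponentials is invisible in the intensity.\<close>

lemma AE_coded_intensity_neq:
  fixes h h' :: "int \<times> int \<Rightarrow> complex" and b m :: "int \<times> int"
  assumes mask: "mask_assumption M p \<phi>" and p: "p > 0"
    and b: "b = ((int p - 1) div 2, (int p - 1) div 2)"
    and m: "m \<in> Zsym p \<times> Zsym p" "m \<noteq> b"
    and neq: "exp (\<i> * \<kappa> * h m) * cnj (exp (\<i> * \<kappa> * h b)) \<noteq> exp (\<i> * \<kappa> * h' m) * cnj (exp (\<i> * \<kappa> * h' b))"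
  shows "AE \<omega> in M. \<not> (\<forall>w\<in>{-1/2..1/2} \<times> {-1/2..1/2}.
    coded_intensity p (phase_mask \<phi> \<omega>) h w = coded_intensity p (phase_mask \<phi> \<omega>) h' w)"
proof -
  interpret prob_space M using mask by (simp add: mask_assumption_def)
  let ?G = "Zsym p \<times> Zsym p"
  define v where "v = (\<lambda>a. exp (\<i> * \<kappa> * h a))"
  define u where "u = (\<lambda>a. exp (\<i> * \<kappa> * h' a))"
  define C where "C = (\<lambda>x. v (fst x) * cnj (v (snd x)) - u (fst x) * cnj (u (snd x)))"
  define \<mu> where "\<mu> = phase_mask \<phi>"
  define E where "E = {x \<in> ?G \<times> ?G. fst x - snd x = m - b}"
  define D where "D = E - {(m, b)}"
  have bG: "b \<in> ?G" using p by (auto simp: b Zsym_def)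
  have fin: "finite E" by (simp add: E_def Zsym_def)
  have Ein: "(m, b) \<in> E" using m bG by (simp add: E_def)
  \<comment> \<open>A pair with second entry \<open>b\<close> has first entry \<open>m\<close> and
    was removed. First entry \<open>b\<close> would force the second to be 2b - m, which exceeds the
    corner \<open>b\<close> in some coordinate.\<close>
  have D: "D \<subseteq> (?G - {b}) \<times> (?G - {b})"
  proof
    fix x assume x: "x \<in> D"
    obtain a1 a2 c1 c2 where xe: "x = ((a1, a2), (c1, c2))" by (metis surj_pair)
    obtain m1 m2 where me: "m = (m1, m2)" by (metis surj_pair)
    show "x \<in> (?G - {b}) \<times> (?G - {b})"
      using x m unfolding D_def E_def xe me b Zsym_def by auto
  qed
  have "AE \<omega> in M. C (m, b) * (\<mu> \<omega> m * cnj (\<mu> \<omega> b)) +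
    (\<Sum>x\<in>D. C x * (\<mu> \<omega> (fst x) * cnj (\<mu> \<omega> (snd x)))) \<noteq> 0"
    unfolding \<mu>_def phase_mask_def
  proof (rule AE_phase_sum_nonzero)
    show "indep_vars (\<lambda>_. borel) \<phi> ?G" "isCont (cdf (distr M borel (\<phi> b))) x" for x
      using mask bG by (auto simp: mask_assumption_def)
    show "C (m, b) \<noteq> 0" using neq by (simp add: C_def u_def v_def)
  qed (use bG m D in auto)
  then show ?thesis
  proof (rule AE_mp, intro AE_I2 impI notI)
    fix \<omega>
    assume nz: "C (m, b) * (\<mu> \<omega> m * cnj (\<mu> \<omega> b)) +
      (\<Sum>x\<in>D. C x * (\<mu> \<omega> (fst x) * cnj (\<mu> \<omega> (snd x)))) \<noteq> 0"
    assume eq: "\<forall>w\<in>{-1/2..1/2} \<times> {-1/2..1/2}.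
      coded_intensity p (phase_mask \<phi> \<omega>) h w = coded_intensity p (phase_mask \<phi> \<omega>) h' w"
    define s where "s = (\<lambda>j. real j / real (2 * p) - 1/2)"
    have s: "s j \<in> {-1/2..1/2}" if "j < 2 * p" for j
      using that by (auto simp: s_def field_simps)
    have md: "\<bar>fst (m - b)\<bar> \<le> int p" "\<bar>snd (m - b)\<bar> \<le> int p"
      using m p by (auto simp: b Zsym_def)
    let ?S = "\<lambda>k. \<Sum>j<2 * p. \<Sum>i<2 * p. of_real (coded_intensity p (\<mu> \<omega>) k (s j, s i)) *
      exp (\<i> * of_real (2 * pi * (of_int (fst (m - b)) * s j + of_int (snd (m - b)) * s i)))"
    have S: "?S k = of_nat (2 * p) ^ 2 * (\<Sum>(a, c)\<in>E.
        \<mu> \<omega> a * exp (\<i> * \<kappa> * k a) * cnj (\<mu> \<omega> c * exp (\<i> * \<kappa> * k c)))" for k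
      unfolding coded_intensity_def s_def E_def
      by (rule fourier_autocorrelation[OF md p])
    have "?S h = ?S h'"
      using eq s unfolding \<mu>_def by (intro sum.cong refl) auto
    then have "(\<Sum>(a, c)\<in>E. \<mu> \<omega> a * v a * cnj (\<mu> \<omega> c * v c)) =
        (\<Sum>(a, c)\<in>E. \<mu> \<omega> a * u a * cnj (\<mu> \<omega> c * u c))"
      using p unfolding S u_def v_def by simp
    \<comment> \<open>Both autocorrelations carry the same mask factors, so their difference has the
      deterministic coefficients \<open>C\<close>.\<close>
    then have "(\<Sum>x\<in>E. C x * (\<mu> \<omega> (fst x) * cnj (\<mu> \<omega> (snd x)))) = 0"
      by (simp add: C_def case_prod_unfold algebra_simps sum_subtractf)
    then show False
      using nz sum.remove[OF fin Ein, of "\<lambda>x. C x * (\<mu> \<omega> (fst x) * cnj (\<mu> \<omega> (snd x)))"]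
      by (simp add: D_def)
  qed
qed

section \<open>Application to the discrete projections\<close>

text \<open>The conclusion does not involve the mask. Either it holds outright, or the equality of
  intensities fails almost surely and the implication is vacuous there.\<close>

lemma AE_single_direction:
  assumes n: "odd n" "n > 1" and p: "p = 2 * n - 1"
    and supp_f: "{m. tproj n l f s m \<noteq> 0} \<subseteq> Zsym n \<times> Zsym n"
    and supp_g: "{m. tproj n l g s m \<noteq> 0} \<subseteq> Zsym n \<times> Zsym n"
    and mask: "mask_assumption M p \<phi>"
  shows "AE \<omega> in M. (\<forall>w \<in> {-1/2..1/2} \<times> {-1/2..1/2}.
      coded_intensity p (phase_mask \<phi> \<omega>) (tproj n l g s) w
        = coded_intensity p (phase_mask \<phi> \<omega>) (tproj n l f s) w) \<longrightarrow>
    (\<forall>c. exp (\<i> * \<kappa> * discrete_proj n g s c) = exp (\<i> * \<kappa> * discrete_proj n f s c))"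
proof (cases "\<forall>c. exp (\<i> * \<kappa> * discrete_proj n g s c) = exp (\<i> * \<kappa> * discrete_proj n f s c)")
  case False
  then obtain c where c: "exp (\<i> * \<kappa> * discrete_proj n g s c) \<noteq> exp (\<i> * \<kappa> * discrete_proj n f s c)"
    by blast
  define m where "m = c - l s"
  define b where "b = ((int p - 1) div 2, (int p - 1) div 2)"
  have neq: "exp (\<i> * \<kappa> * tproj n l g s m) \<noteq> exp (\<i> * \<kappa> * tproj n l f s m)"
    using c by (simp add: tproj_def m_def)
  \<comment> \<open>Were both values zero, both exponentials would be 1.\<close>
  then have "tproj n l g s m \<noteq> 0 \<or> tproj n l f s m \<noteq> 0" by auto
  then have m: "m \<in> Zsym n \<times> Zsym n" using supp_f supp_g by auto
  \<comment> \<open>The coordinates of \<open>b\<close> are n - 1, beyond the bound (n - 1)/2 of the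
    small square because n > 1.\<close>
  have bn: "b \<notin> Zsym n \<times> Zsym n" using n p by (auto simp: b_def Zsym_def)
  \<comment> \<open>Both exponentials at \<open>b\<close> are therefore 1, so the required
    inequality of products reduces to \<open>neq\<close>.\<close>
  then have b0: "tproj n l g s b = 0" "tproj n l f s b = 0" using supp_f supp_g by auto
  have "AE \<omega> in M. \<not> (\<forall>w\<in>{-1/2..1/2} \<times> {-1/2..1/2}.
    coded_intensity p (phase_mask \<phi> \<omega>) (tproj n l g s) w
      = coded_intensity p (phase_mask \<phi> \<omega>) (tproj n l f s) w)"
  proof (rule AE_coded_intensity_neq[OF mask _ b_def])
    show "m \<in> Zsym p \<times> Zsym p" using m n p by (auto simp: Zsym_def)
    show "m \<noteq> b" using m bn by auto
  qed (use n p neq b0 in auto)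
  then show ?thesis by (rule AE_mp) (rule AE_I2, blast)
qed simp

theorem theorem3p2:
  fixes n p :: nat
    and t t' :: "real \<times> real \<times> real"
    and f g :: object3
    and l :: "real \<times> real \<times> real \<Rightarrow> int \<times> int"
    and M :: "'w measure"
    and \<phi> :: "int \<times> int \<Rightarrow> 'w \<Rightarrow> real"
  assumes "odd n" and "n > 1" and "p = 2 * n - 1"
    and "is_direction t" and "is_direction t'" and "\<not> parallel_dirs t t'"
    and "\<forall>s\<in>{t, t'}. {m. tproj n l f s m \<noteq> 0} \<subseteq> Zsym n \<times> Zsym n"
    and "\<forall>s\<in>{t, t'}. {m. tproj n l g s m \<noteq> 0} \<subseteq> Zsym n \<times> Zsym n"
    and "\<exists>(k, k') \<in> common_set n t t' f \<inter> common_set n t t' g.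
           (k, k') \<noteq> 0 \<and> (slope_not_fraction p k \<or> slope_not_fraction p k')"
    and "mask_assumption M p \<phi>"
  shows "AE \<omega> in M.
     (\<forall>w \<in> {-1/2..1/2} \<times> {-1/2..1/2}.
        coded_intensity p (phase_mask \<phi> \<omega>) (tproj n l g t') w
          = coded_intensity p (phase_mask \<phi> \<omega>) (tproj n l f t') w) \<and>
     (\<forall>w \<in> {-1/2..1/2} \<times> {-1/2..1/2}.
        coded_intensity p (phase_mask \<phi> \<omega>) (tproj n l g t) w
          = coded_intensity p (phase_mask \<phi> \<omega>) (tproj n l f t) w)
     \<longrightarrow>
     (\<forall>c \<in> Zsym p \<times> Zsym p. exp (\<i> * \<kappa> * discrete_proj n g t c) = exp (\<i> * \<kappa> * discrete_proj n f t c)) \<and>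
     (\<forall>c \<in> Zsym p \<times> Zsym p. exp (\<i> * \<kappa> * discrete_proj n g t' c) = exp (\<i> * \<kappa> * discrete_proj n f t' c))"
proof -
  \<comment> \<open>The exceptional null sets of the two directions are merged, the index set being
    finite.\<close>
  have "AE \<omega> in M. \<forall>s\<in>{t, t'}. (\<forall>w \<in> {-1/2..1/2} \<times> {-1/2..1/2}.
      coded_intensity p (phase_mask \<phi> \<omega>) (tproj n l g s) w
        = coded_intensity p (phase_mask \<phi> \<omega>) (tproj n l f s) w) \<longrightarrow>
    (\<forall>c. exp (\<i> * \<kappa> * discrete_proj n g s c) = exp (\<i> * \<kappa> * discrete_proj n f s c))"
    using assms by (intro AE_finite_allI AE_single_direction) auto
  then show ?thesis by (rule AE_mp) (intro AE_I2 impI, blast)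
qed

end
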